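(* Let $T_{n,k}(x,t,s)$ be the normal-ordering coefficients defined by $(x+tD-sD^2)^n=\sum_{k=0}^{2n}T_{n,k}(x,t,s)D^k$, and let $\mathcal H_n(x,t,s)=P_{t,s}(x^n)$ be the Heat--Airy polynomials. For every $n\ge0$, $$T_{n,0}(x,t,s)=\mathcal H_n(x,t,s).$$
   Context: $D=\frac{d}{dx}$; $x$ denotes multiplication by $x$ in operator expressions; every polynomial differential operator is written uniquely in normal form with all powers of $D$ on the right. $P_{t,s}=\exp\left(\frac t2D^2-\frac s3D^3\right)$ acts on polynomials in $x$ by its exponential series (a finite sum on each polynomial), $t,s\ge0$. *)

theory Defs
  imports
    "HOL-Computational_Algebra.Polynomial"
    "HOL-Library.Groups_Big_Fun"
begin

text \<open>
  Differential operators with polynomial coefficients are represented by their action on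
  \<^typ>\<open>real poly\<close>; in characteristic zero this action is faithful
  (see \<open>normal_form_unique\<close> below). Composition of operators is composition of functions,
  \<open>D\<close> is \<^const>\<open>pderiv\<close>, and the parameters \<open>t, s\<close> are real numbers.
\<close>

definition ladder_op :: "real \<Rightarrow> real \<Rightarrow> real poly \<Rightarrow> real poly" where
  "ladder_op t s p = [:0, 1:] * p + smult t (pderiv p) - smult s ((pderiv ^^ 2) p)"

definition is_normal_form :: "nat \<Rightarrow> (real poly \<Rightarrow> real poly) \<Rightarrow> (nat \<Rightarrow> real poly) \<Rightarrow> bool" where
  "is_normal_form N A c \<longleftrightarrow>
     (\<forall>k>N. c k = 0) \<and> (\<forall>p. A p = (\<Sum>k\<le>N. c k * (pderiv ^^ k) p))"

text \<open>
  The normal-ordering coefficient \<open>T\<^sub>n\<^sub>,\<^sub>k(x,t,s)\<close>, as a polynomial in \<open>x\<close> (and \<open>0\<close> for \<open>k > 2n\<close>).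
  The description is legitimate by \<open>normal_ordering_ex1\<close> below.
\<close>

definition normal_T :: "nat \<Rightarrow> nat \<Rightarrow> real \<Rightarrow> real \<Rightarrow> real poly" where
  "normal_T n k t s = (THE c. is_normal_form (2 * n) (ladder_op t s ^^ n) c) k"

definition heat_airy_gen :: "real \<Rightarrow> real \<Rightarrow> real poly \<Rightarrow> real poly" where
  "heat_airy_gen t s p = smult (t / 2) ((pderiv ^^ 2) p) - smult (s / 3) ((pderiv ^^ 3) p)"

text \<open>
  The exponential series of \<^const>\<open>heat_airy_gen\<close>. \<^const>\<open>Sum_any\<close> sums over all natural
  numbers with nonzero summand; there are finitely many by \<open>heat_airy_exp_finite\<close> below.
\<close>

definition heat_airy_exp :: "real \<Rightarrow> real \<Rightarrow> real poly \<Rightarrow> real poly" where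
  "heat_airy_exp t s p = Sum_any (\<lambda>m. smult (1 / fact m) ((heat_airy_gen t s ^^ m) p))"

definition heat_airy_poly :: "nat \<Rightarrow> real \<Rightarrow> real \<Rightarrow> real poly" where
  "heat_airy_poly n t s = heat_airy_exp t s ([:0, 1:] ^ n)"

lemma higher_pderiv_degree_0: "degree p < k \<Longrightarrow> (pderiv ^^ k) p = 0" for p :: "real poly"
proof (induction k arbitrary: p)
  case (Suc k)
  show ?case
  proof (cases "degree p = 0")
    case True
    then have "pderiv p = 0" by (simp add: pderiv_eq_0_iff)
    then show ?thesis
      by (simp add: funpow_Suc_right del: funpow.simps)
  next
    case False
    then have "degree (pderiv p) < k" using Suc.prems by (simp add: degree_pderiv)
    then show ?thesis using Suc.IH by (simp add: funpow_Suc_right del: funpow.simps)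
  qed
qed simp

lemma higher_pderiv_X_power: "(pderiv ^^ k) (monom 1 k) = ([:fact k:] :: real poly)"
proof (induction k)
  case (Suc k)
  have "pderiv (monom 1 (Suc k)) = smult (real (Suc k)) (monom (1::real) k)"
    by (simp add: pderiv_monom smult_monom)
  then show ?case
    using Suc by (simp add: funpow_Suc_right higher_pderiv_smult algebra_simps del: funpow.simps)
qed (simp add: monom_0)

lemma normal_form_unique:
  assumes c: "is_normal_form N A c" and d: "is_normal_form N A d"
  shows "c = d"
proof
  fix j
  show "c j = d j"
  proof (induction j rule: less_induct)
    case (less j)
    show ?case
    proof (cases "j \<le> N")
      case True
      let ?m = "monom (1::real) j"
      have "A ?m = (\<Sum>k\<le>N. c k * (pderiv ^^ k) ?m)"
        using c unfolding is_normal_form_def by blast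
      moreover have "A ?m = (\<Sum>k\<le>N. d k * (pderiv ^^ k) ?m)"
        using d unfolding is_normal_form_def by blast
      ultimately have "(\<Sum>k\<le>N. c k * (pderiv ^^ k) ?m) = (\<Sum>k\<le>N. d k * (pderiv ^^ k) ?m)"
        by (rule subst)
      then have "(\<Sum>k\<le>N. (c k - d k) * (pderiv ^^ k) ?m) = 0"
        by (simp only: left_diff_distrib sum_subtractf diff_self)
      moreover have "(\<Sum>k\<le>N. (c k - d k) * (pderiv ^^ k) ?m) =
          (\<Sum>k\<in>{j}. (c k - d k) * (pderiv ^^ k) ?m)"
      proof (rule sum.mono_neutral_right)
        show "\<forall>i\<in>{..N} - {j}. (c i - d i) * (pderiv ^^ i) ?m = 0"
        proof
          fix i assume "i \<in> {..N} - {j}"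
          then consider "i < j" | "j < i" by force
          then show "(c i - d i) * (pderiv ^^ i) ?m = 0"
            by cases (auto simp: less higher_pderiv_degree_0 degree_monom_eq)
        qed
      qed (use True in auto)
      ultimately show ?thesis by (simp add: higher_pderiv_X_power)
    next
      case False
      then show ?thesis using c d by (simp add: is_normal_form_def)
    qed
  qed
qed

lemma normal_form_mono:
  assumes "is_normal_form N A c" "N \<le> M"
  shows "is_normal_form M A c"
proof -
  have "(\<Sum>k\<le>N. c k * (pderiv ^^ k) p) = (\<Sum>k\<le>M. c k * (pderiv ^^ k) p)" for p
    by (rule sum.mono_neutral_left) (use assms in \<open>auto simp: is_normal_form_def\<close>)
  then show ?thesis using assms by (auto simp: is_normal_form_def)
qed

lemma normal_form_pderiv:
  assumes "is_normal_form N A c"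
  shows "is_normal_form (Suc N) (\<lambda>p. pderiv (A p))
           (\<lambda>k. pderiv (c k) + (case k of 0 \<Rightarrow> 0 | Suc j \<Rightarrow> c j))"
proof -
  let ?e = "\<lambda>k. case k of 0 \<Rightarrow> 0 | Suc j \<Rightarrow> c j"
  have "pderiv (A p) = (\<Sum>k\<le>Suc N. (pderiv (c k) + ?e k) * (pderiv ^^ k) p)" for p
  proof -
    have "pderiv (A p) = (\<Sum>k\<le>N. pderiv (c k) * (pderiv ^^ k) p) +
        (\<Sum>k\<le>N. c k * (pderiv ^^ Suc k) p)"
    proof -
      have "A p = (\<Sum>k\<le>N. c k * (pderiv ^^ k) p)"
        using assms unfolding is_normal_form_def by blast
      then show ?thesis
        by (simp add: higher_pderiv_sum[of 1, simplified] pderiv_mult sum.distrib algebra_simps)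
    qed
    also have "(\<Sum>k\<le>N. c k * (pderiv ^^ Suc k) p) = (\<Sum>k\<le>Suc N. ?e k * (pderiv ^^ k) p)"
      by (subst sum.atMost_Suc_shift) simp
    also have "(\<Sum>k\<le>N. pderiv (c k) * (pderiv ^^ k) p) =
        (\<Sum>k\<le>Suc N. pderiv (c k) * (pderiv ^^ k) p)"
      using assms by (simp add: is_normal_form_def)
    finally show ?thesis by (simp only: sum.distrib distrib_right)
  qed
  then show ?thesis
    using assms by (auto simp: is_normal_form_def split: nat.split)
qed

theorem normal_ordering_ex1: "\<exists>!c. is_normal_form (2 * n) (ladder_op t s ^^ n) c"
proof (rule ex_ex1I)
  show "\<exists>c. is_normal_form (2 * n) (ladder_op t s ^^ n) c"
  proof (induction n)
    case 0
    show ?case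
      by (rule exI[of _ "\<lambda>k. if k = 0 then 1 else 0"]) (simp add: is_normal_form_def)
  next
    case (Suc n)
    let ?A = "ladder_op t s ^^ n"
    from Suc obtain c where c: "is_normal_form (2 * n) ?A c" by blast
    from normal_form_pderiv[OF c] obtain d
      where d: "is_normal_form (Suc (2 * n)) (\<lambda>p. pderiv (?A p)) d" by blast
    from normal_form_pderiv[OF d] obtain e
      where e: "is_normal_form (2 * Suc n) (\<lambda>p. pderiv (pderiv (?A p))) e" by auto
    have c': "is_normal_form (2 * Suc n) ?A c" using c by (rule normal_form_mono) simp
    have d': "is_normal_form (2 * Suc n) (\<lambda>p. pderiv (?A p)) d"
      using d by (rule normal_form_mono) simp
    let ?c = "\<lambda>k. [:0, 1:] * c k + smult t (d k) - smult s (e k)"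
    have A: "(ladder_op t s ^^ Suc n) p = [:0, 1:] * ?A p + smult t (pderiv (?A p)) -
        smult s (pderiv (pderiv (?A p)))" for p
      by (simp add: ladder_op_def numeral_2_eq_2)
    have "(ladder_op t s ^^ Suc n) p = (\<Sum>k\<le>2 * Suc n. ?c k * (pderiv ^^ k) p)" for p
    proof -
      let ?S = "\<lambda>f. \<Sum>k\<le>2 * Suc n. f k * (pderiv ^^ k) p"
      have sm: "smult a (sum f S) = (\<Sum>k\<in>S. smult a (f k))"
        for a and f :: "nat \<Rightarrow> real poly" and S
        by (induction S rule: infinite_finite_induct) (auto simp: smult_add_right)
      have 1: "?A p = ?S c" using c' unfolding is_normal_form_def by blast
      have 2: "pderiv (?A p) = ?S d" using d' unfolding is_normal_form_def by blast
      have 3: "pderiv (pderiv (?A p)) = ?S e" using e unfolding is_normal_form_def by blast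
      have "(ladder_op t s ^^ Suc n) p = [:0, 1:] * ?S c + smult t (?S d) - smult s (?S e)"
        by (subst A, subst 3, subst 2, subst 1, rule refl)
      also have "\<dots> = ?S ?c"
        by (simp only: sm sum_distrib_left sum.distrib[symmetric] sum_subtractf[symmetric]
              distrib_right left_diff_distrib mult_smult_left mult.assoc)
      finally show ?thesis .
    qed
    then have 5: "\<forall>p. (ladder_op t s ^^ Suc n) p = (\<Sum>k\<le>2 * Suc n. ?c k * (pderiv ^^ k) p)"
      by (rule allI)
    have 4: "\<forall>k>2 * Suc n. ?c k = 0"
      using c' d' e by (simp add: is_normal_form_def)
    have "is_normal_form (2 * Suc n) (ladder_op t s ^^ Suc n) ?c"
      unfolding is_normal_form_def using 4 5 by (rule conjI)
    then show ?case by (rule exI[of _ ?c])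
  qed
qed (rule normal_form_unique)

lemma degree_heat_airy_gen: "degree (heat_airy_gen t s p) \<le> degree p - 1"
proof -
  have "degree ((pderiv ^^ Suc m) p) \<le> degree p - 1" for m
    by (induction m) (auto simp: degree_pderiv)
  from this[of 1] this[of 2] show ?thesis
    unfolding heat_airy_gen_def eval_nat_numeral
    by (intro degree_diff_le) (auto intro: order.trans[OF degree_smult_le])
qed

theorem heat_airy_exp_finite:
  "finite {m. smult (1 / fact m) ((heat_airy_gen t s ^^ m) p) \<noteq> 0}"
proof -
  have deg: "degree ((heat_airy_gen t s ^^ m) p) \<le> degree p - m" for m
  proof (induction m)
    case (Suc m)
    then show ?case
      using degree_heat_airy_gen[of t s "(heat_airy_gen t s ^^ m) p"] by simp
  qed simp
  have "(heat_airy_gen t s ^^ m) p = 0" if "degree p < m" for m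
  proof -
    from that obtain j where j: "m = Suc j" "degree p \<le> j" by (cases m) auto
    then have "degree ((heat_airy_gen t s ^^ j) p) = 0" using deg[of j] by simp
    then show ?thesis
      by (simp add: j heat_airy_gen_def higher_pderiv_degree_0 del: funpow.simps(2))
        (simp add: heat_airy_gen_def higher_pderiv_degree_0)
  qed
  then have "{m. smult (1 / fact m) ((heat_airy_gen t s ^^ m) p) \<noteq> 0} \<subseteq> {..degree p}"
    by (auto simp: not_less[symmetric])
  then show ?thesis by (rule finite_subset) simp
qed

end

theory Submission
  imports Defs
begin

text \<open>
  Write \<open>G = t/2 D\<^sup>2 - s/3 D\<^sup>3\<close>, \<open>K = tD - sD\<^sup>2\<close>. Since \<open>[G, x] = K\<close> commutes with \<open>G\<close>, we have
  \<open>[G\<^sup>m, x] = m K G\<^sup>m\<^sup>-\<^sup>1\<close>, and summing the exponential series gives \<open>exp(G) x = (x + K) exp(G)\<close>.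
  Hence \<open>exp(G) x\<^sup>n = (x + K)\<^sup>n 1\<close>, and evaluating the normal form of \<open>(x + K)\<^sup>n\<close> at \<open>1\<close> leaves
  exactly its \<open>D\<^sup>0\<close> coefficient.
\<close>

text \<open>This is the operator \<open>K\<close>. Nesting \<open>pderiv\<close> instead of
  iterating it lets the rules for \<open>pderiv\<close> apply directly.\<close>

definition ladder_shift :: "real \<Rightarrow> real \<Rightarrow> real poly \<Rightarrow> real poly" where
  "ladder_shift t s p = smult t (pderiv p) - smult s (pderiv (pderiv p))"

lemma ladder_op_eq: "ladder_op t s p = [:0, 1:] * p + ladder_shift t s p"
  by (simp add: ladder_op_def ladder_shift_def numeral_2_eq_2)

lemma ladder_shift_smult: "ladder_shift t s (smult a p) = smult a (ladder_shift t s p)"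
  by (simp add: ladder_shift_def pderiv_smult smult_diff_right mult.commute)

lemma ladder_shift_0: "ladder_shift t s 0 = 0"
  by (simp add: ladder_shift_def)

lemma ladder_shift_add: "ladder_shift t s (p + q) = ladder_shift t s p + ladder_shift t s q"
  by (simp add: ladder_shift_def pderiv_add smult_add_right)

lemma ladder_shift_sum: "ladder_shift t s (sum f A) = (\<Sum>i\<in>A. ladder_shift t s (f i))"
  by (induction A rule: infinite_finite_induct) (auto simp: ladder_shift_0 ladder_shift_add)

lemma heat_airy_gen_eq:
  "heat_airy_gen t s p =
     smult (t / 2) (pderiv (pderiv p)) - smult (s / 3) (pderiv (pderiv (pderiv p)))"
  by (simp add: heat_airy_gen_def numeral_2_eq_2 numeral_3_eq_3)

lemma heat_airy_gen_add: "heat_airy_gen t s (p + q) = heat_airy_gen t s p + heat_airy_gen t s q"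
  by (simp add: heat_airy_gen_eq pderiv_add smult_add_right)

lemma heat_airy_gen_smult: "heat_airy_gen t s (smult a p) = smult a (heat_airy_gen t s p)"
  by (simp add: heat_airy_gen_eq pderiv_smult smult_diff_right mult.commute)

lemma heat_airy_gen_ladder_shift:
  "heat_airy_gen t s (ladder_shift t s p) = ladder_shift t s (heat_airy_gen t s p)"
  by (simp add: heat_airy_gen_eq ladder_shift_def pderiv_smult pderiv_diff smult_diff_right
      algebra_simps)

text \<open>From [D^k, x] = k D^(k-1): the factors 2 and 3 cancel the denominators in the generator.
  The proof compares coefficients, treating index 0 apart because multiplication by x shifts
  indices.\<close>

lemma heat_airy_gen_X_mult:
  "heat_airy_gen t s ([:0, 1:] * p) = [:0, 1:] * heat_airy_gen t s p + ladder_shift t s p"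
proof (rule poly_eqI)
  fix i
  show "coeff (heat_airy_gen t s ([:0, 1:] * p)) i =
      coeff ([:0, 1:] * heat_airy_gen t s p + ladder_shift t s p) i"
    by (cases i) (simp_all add: heat_airy_gen_eq ladder_shift_def coeff_pderiv field_simps)
qed

text \<open>Each further generator moved past x contributes one more \<open>ladder_shift\<close>.
  All these terms agree because the two operators commute. Using \<open>Suc m\<close> avoids the
  exponent m - 1.\<close>

lemma heat_airy_gen_funpow_X_mult:
  "(heat_airy_gen t s ^^ Suc m) ([:0, 1:] * p) = [:0, 1:] * (heat_airy_gen t s ^^ Suc m) p +
     smult (real (Suc m)) (ladder_shift t s ((heat_airy_gen t s ^^ m) p))"
proof (induction m)
  case 0
  show ?case using heat_airy_gen_X_mult[of t s p] by simp
next
  case (Suc m)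
  let ?G = "heat_airy_gen t s" and ?K = "ladder_shift t s"
  have "(?G ^^ Suc (Suc m)) ([:0, 1:] * p) = ?G ((?G ^^ Suc m) ([:0, 1:] * p))"
    by simp
  also have "\<dots> = ?G ([:0, 1:] * (?G ^^ Suc m) p) +
      ?G (smult (real (Suc m)) (?K ((?G ^^ m) p)))"
    by (simp only: Suc heat_airy_gen_add)
  also have "?G ([:0, 1:] * (?G ^^ Suc m) p) =
      [:0, 1:] * (?G ^^ Suc (Suc m)) p + ?K ((?G ^^ Suc m) p)"
    by (simp only: heat_airy_gen_X_mult funpow.simps o_apply)
  also have "?G (smult (real (Suc m)) (?K ((?G ^^ m) p))) =
      smult (real (Suc m)) (?K ((?G ^^ Suc m) p))"
    by (simp add: heat_airy_gen_smult heat_airy_gen_ladder_shift)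
  finally show ?case
    by (simp only: of_nat_Suc[of "Suc m"] smult_add_left smult_1_left add.assoc)
qed

text \<open>Every large enough cutoff is allowed, so that series of different polynomials can be
  truncated at a common index.\<close>

lemma heat_airy_exp_eq_sum:
  obtains M where "\<And>N. M \<le> N \<Longrightarrow>
    heat_airy_exp t s p = (\<Sum>m\<le>N. smult (1 / fact m) ((heat_airy_gen t s ^^ m) p))"
proof -
  let ?f = "\<lambda>m. smult (1 / fact m) ((heat_airy_gen t s ^^ m) p)"
  obtain M where M: "{m. ?f m \<noteq> 0} \<subseteq> {..M}"
    using heat_airy_exp_finite[of t s p] by (auto simp only: finite_nat_iff_bounded_le)
  have "heat_airy_exp t s p = sum ?f {..N}" if "M \<le> N" for N
    unfolding heat_airy_exp_def
    by (rule Sum_any.expand_superset) (use M that in auto)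
  with that show ?thesis by blast
qed

lemma heat_airy_exp_1: "heat_airy_exp t s 1 = 1"
proof -
  have "(heat_airy_gen t s ^^ m) 1 = 0" if "m > 0" for m
    using that by (induction m rule: nat_induct_non_zero) (simp_all add: heat_airy_gen_eq)
  then have "{m. smult (1 / fact m) ((heat_airy_gen t s ^^ m) 1) \<noteq> 0} \<subseteq> {0}"
    by auto
  then show ?thesis
    unfolding heat_airy_exp_def by (subst Sum_any.expand_superset) auto
qed

lemma heat_airy_exp_X_mult:
  "heat_airy_exp t s ([:0, 1:] * p) = ladder_op t s (heat_airy_exp t s p)"
proof -
  let ?G = "heat_airy_gen t s" and ?K = "ladder_shift t s" and ?X = "[:0, 1:] :: real poly"
  let ?e = "\<lambda>q m. smult (1 / fact m) ((?G ^^ m) q)"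
  obtain M where M: "\<And>N. M \<le> N \<Longrightarrow> heat_airy_exp t s p = sum (?e p) {..N}"
    using heat_airy_exp_eq_sum by blast
  obtain M' where M': "\<And>N. M' \<le> N \<Longrightarrow> heat_airy_exp t s (?X * p) = sum (?e (?X * p)) {..N}"
    using heat_airy_exp_eq_sum by blast
  define N where "N = max M M'"
  \<comment> \<open>The commutator's factor \<open>Suc m\<close> reduces \<open>fact (Suc m)\<close>
    to \<open>fact m\<close>, so the \<open>ladder_shift\<close> part is the preceding term of the
    series for \<open>p\<close>.\<close>
  have step: "?e (?X * p) (Suc m) = ?X * ?e p (Suc m) + ?K (?e p m)" for m
  proof -
    have "1 / fact (Suc m) * real (Suc m) = 1 / fact m"
      by (simp add: divide_simps)
    then show ?thesis
      by (simp only: heat_airy_gen_funpow_X_mult smult_add_right mult_smult_right smult_smult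
          ladder_shift_smult)
  qed
  \<comment> \<open>Cutting at \<open>Suc N\<close> leaves the x part a sum up to
    \<open>Suc N\<close> and the shifted part a sum up to \<open>N\<close>; both cutoffs are at
    least \<open>M\<close>, so each sum is the whole exponential.\<close>
  have "heat_airy_exp t s (?X * p) = sum (?e (?X * p)) {..Suc N}"
    by (rule M') (simp add: N_def)
  also have "\<dots> = ?X * ?e p 0 + (\<Sum>m\<le>N. ?X * ?e p (Suc m) + ?K (?e p m))"
    by (simp only: sum.atMost_Suc_shift step) simp
  also have "\<dots> = ?X * sum (?e p) {..Suc N} + ?K (sum (?e p) {..N})"
    by (simp only: sum.atMost_Suc_shift sum.distrib sum_distrib_left distrib_left
        ladder_shift_sum add.assoc)
  also have "sum (?e p) {..Suc N} = heat_airy_exp t s p"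
    by (rule M[symmetric]) (simp add: N_def)
  also have "sum (?e p) {..N} = heat_airy_exp t s p"
    by (rule M[symmetric]) (simp add: N_def)
  finally show ?thesis by (simp only: ladder_op_eq)
qed

lemma heat_airy_poly_eq_ladder_op_funpow: "heat_airy_poly n t s = (ladder_op t s ^^ n) 1"
  unfolding heat_airy_poly_def
proof (induction n)
  case 0
  show ?case by (simp add: heat_airy_exp_1)
next
  case (Suc n)
  then show ?case by (simp only: power_Suc heat_airy_exp_X_mult funpow.simps o_apply)
qed

text \<open>All derivatives of positive order annihilate the constant 1.\<close>

lemma is_normal_form_apply_1:
  assumes "is_normal_form N A c"
  shows "A 1 = c 0"
proof -
  have "A 1 = (\<Sum>k\<le>N. c k * (pderiv ^^ k) 1)"
    using assms unfolding is_normal_form_def by blast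
  also have "\<dots> = (\<Sum>k\<in>{0}. c k * (pderiv ^^ k) 1)"
    by (rule sum.mono_neutral_right) (auto simp: higher_pderiv_degree_0)
  finally show ?thesis by simp
qed

theorem theorem4p4:
  fixes n :: nat and t s :: real
  assumes "t \<ge> 0" and "s \<ge> 0"
  shows "normal_T n 0 t s = heat_airy_poly n t s"
  unfolding normal_T_def heat_airy_poly_eq_ladder_op_funpow
  \<comment> \<open>Unique existence makes the description in \<open>normal_T\<close> an actual
    normal form, which is then evaluated at 1.\<close>
  by (rule is_normal_form_apply_1[OF theI'[OF normal_ordering_ex1], symmetric])

end
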